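(* Let $\mathbb{F}$ be a field with characteristic not $2$, let $\ell, m, n\ge 1$ be integers, and let $A_i\in\mathbb{F}^{m\times n}$, $B_i\in\mathbb{F}^{n\times m}$, $C_i\in\mathbb{F}^{m\times m}$ for $i=1,\ldots,\ell$. Let $\star$ denote either the transpose or, when $\mathbb{F}=\mathbb{C}$, the conjugate transpose. Then the following statements are equivalent: (a) The system of $\star$-Sylvester equations $$A_iX-X^\star B_i=C_i,\qquad i=1,\ldots,\ell,$$ has a solution $X\in\mathbb{F}^{n\times m}$ (a single $X$ satisfying all $\ell$ equations simultaneously). (b) There is an invertible matrix $S\in\mathbb{F}^{(m+n)\times(m+n)}$ such that $$S\begin{bmatrix} C_i & -A_i \\ B_i & 0 \end{bmatrix}S^\star=\begin{bmatrix} 0 & -A_i \\ B_i & 0 \end{bmatrix}\qquad\text{for all } i=1,\ldots,\ell.$$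
   Context: $\mathbb{F}^{p\times q}$ denotes the set of $p\times q$ matrices with entries in $\mathbb{F}$. The operation $(\cdot)^\star$ is fixed throughout the statement: it is either the transpose $M\mapsto M^{T}$ (for any field $\mathbb{F}$ of characteristic not $2$), or, in the case $\mathbb{F}=\mathbb{C}$, it may alternatively be the conjugate transpose $M\mapsto \overline{M}^{T}$. The result is asserted for each of these choices. In the block matrices, the top-left block has size $m\times m$ and the bottom-right zero block has size $n\times n$. *)

theory Defs
  imports Complex_Main
    "HOL-Computational_Algebra.Computational_Algebra"
    "Jordan_Normal_Form.Matrix"
    "Jordan_Normal_Form.Schur_Decomposition"
begin

(* star is instantiated by transpose_mat (over any field) or by mat_adjoint over complex,
   where conjugate = cnj, so that mat_adjoint is the conjugate transpose. *)

definition star_Sylvester_solvable ::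
  "('a::field mat \<Rightarrow> 'a mat) \<Rightarrow> nat \<Rightarrow> nat \<Rightarrow> nat \<Rightarrow>
     (nat \<Rightarrow> 'a mat) \<Rightarrow> (nat \<Rightarrow> 'a mat) \<Rightarrow> (nat \<Rightarrow> 'a mat) \<Rightarrow> bool" where
  "star_Sylvester_solvable star l m n A B C \<longleftrightarrow>
     (\<exists>X \<in> carrier_mat n m. \<forall>i\<in>{1..l}. A i * X - star X * B i = C i)"

lemma mat_adjoint_complex:
  "mat_adjoint (M :: complex mat) = map_mat cnj (transpose_mat M)"
  by (rule eq_matI) (auto simp: mat_adjoint_def mat_of_rows_def)

definition simultaneously_star_congruent ::
  "('a::field mat \<Rightarrow> 'a mat) \<Rightarrow> nat \<Rightarrow> nat \<Rightarrow>
     (nat \<Rightarrow> 'a mat) \<Rightarrow> (nat \<Rightarrow> 'a mat) \<Rightarrow> bool" where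
  "simultaneously_star_congruent star l k M N \<longleftrightarrow>
     (\<exists>S \<in> carrier_mat k k. invertible_mat S \<and> (\<forall>i\<in>{1..l}. S * M i * star S = N i))"

end

theory Submission
  imports Defs "HOL-Library.Function_Algebras"
begin

text \<open>
  Let \<open>M i\<close> and \<open>N i\<close> be the block matrices on the left and on the right of the congruence. A
  solution X of the star-Sylvester system gives the congruence at once, with the unitriangular S
  that has the blocks I and X* in its first and 0 and I in its second block row.

  The converse is a dimension count in the style of Flanders and Wimmer. Suppose first only that
  \<open>S * M t * T = N t\<close> for all t in some index set, with S and T invertible and unrelated. Let L be
  the space of pairs (P, Q) with \<open>P * M t = N t * Q\<close> for all t, and L' the space of pairs with
  \<open>P * N t = N t * Q\<close> for all t. The substitution (P, Q) \<mapsto> (P S, Q T\<inverse>) maps L' isomorphically onto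
  L, so both have the same dimension. Project a pair to the first m columns of P. As \<open>M t\<close> and
  \<open>N t\<close> differ only in their top left blocks, the pairs with projection 0 are the same in L and in
  L'; and a pair in L can be changed into one in L' with the same projection by erasing the other
  columns of P and the first m columns of Q. Thus the image of L is contained in the image of L',
  has the same dimension, and is equal to it. Since (I, I) lies in L', there is a pair in L for
  which P has the same first m columns as the identity matrix. The top left block of
  \<open>P * M t = N t * Q\<close> then says that \<open>A t * Y - Z * B t = C t\<close>, where Z and -Y are blocks of P and Q.
  This is \<open>Sylvester_solvable_if_equivalent\<close>.

  Nothing relates Y to Z here. To relate them, apply the result to the matrices \<open>M i\<close> and
  \<open>star (M i)\<close> together, which the congruence transforms by the same S and T = S*. The equation from
  \<open>star (M i)\<close>, starred, is \<open>A i * star Z - star Y * B i = C i\<close>, and averaging it with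
  \<open>A i * Y - Z * B i = C i\<close> shows that X = (Y + Z*)/2 is a solution. This division by 2 is where
  the characteristic matters.

  Transpose and conjugate transpose are treated as one operation: transpose every matrix and apply
  an involutive field automorphism \<sigma> to its entries, with \<sigma> the identity or the conjugation.
\<close>

section \<open>Images under maps with the same kernel\<close>

context vector_space
begin

lemma injective_endomorphism_on_span_surj:
  assumes B: "finite B" "independent B"
    and F: "Vector_Spaces.linear scale scale F" "inj_on F (span B)" "F ` span B \<subseteq> span B"
  shows "F ` span B = span B"
proof -
  interpret F: Vector_Spaces.linear scale scale F by fact
  have indep: "independent (F ` B)"
    by (rule F.independent_injective_image[OF B(2) F(2)])
  have card: "card (F ` B) = card B"
    using F(2) span_superset by (blast intro: card_image inj_on_subset)
  have "y \<in> span (F ` B)" if y: "y \<in> span B" for y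
  proof (rule ccontr)
    assume notin: "y \<notin> span (F ` B)"
    then have "independent (insert y (F ` B))"
      using indep by (rule independent_insertI)
    moreover have "insert y (F ` B) \<subseteq> span B"
      using y F(3) span_superset by blast
    ultimately have "card (insert y (F ` B)) \<le> card B"
      using independent_span_bound[OF B(1)] by blast
    moreover have "y \<notin> F ` B"
      using notin span_base by blast
    ultimately show False
      using B(1) card by simp
  qed
  then show ?thesis
    using F(3) F.span_image[of B] by blast
qed

text \<open>
  This is rank-nullity for L and L' without speaking of dimensions. Lifting a basis of L that extends
  a basis of the common kernel gives an injective linear map G from L to L' that respects p.
  Composed with F, it is an injective endomorphism of the finitely generated space L, hence
  surjective. So G is onto L', and p takes no value on L' that it does not take on L.
\<close>

lemma image_eq_of_same_kernel:
  assumes L: "subspace L" "subspace L'"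
    and fin: "finite T" "L \<subseteq> span T"
    and p: "Vector_Spaces.linear scale scale p" "p ` L \<subseteq> p ` L'"
    and ker: "\<And>x. p x = 0 \<Longrightarrow> x \<in> L \<longleftrightarrow> x \<in> L'"
    and F: "Vector_Spaces.linear scale scale F" "inj_on F L'" "F ` L' \<subseteq> L"
  shows "p ` L = p ` L'"
proof -
  interpret pair: vector_space_pair scale scale by unfold_locales
  interpret p: Vector_Spaces.linear scale scale p by fact
  interpret F: Vector_Spaces.linear scale scale F by fact
  define K where "K = {x \<in> L. p x = 0}"
  obtain BK where BK: "BK \<subseteq> K" "independent BK" "K \<subseteq> span BK"
    using maximal_independent_subset[of K] by metis
  have "BK \<subseteq> L"
    using BK(1) by (auto simp: K_def)
  then obtain B where B: "BK \<subseteq> B" "B \<subseteq> L" "independent B" "L \<subseteq> span B"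
    using BK(2) by (metis maximal_independent_subset_extend)
  have spanB: "span B = L"
    using B(2,4) L(1) span_minimal by blast
  have finB: "finite B"
    using independent_span_bound[OF fin(1) B(3)] B(2) fin(2) by blast
  \<comment> \<open>On the basis of the kernel the lift has to be the identity: this makes G injective.\<close>
  have "\<exists>h. \<forall>b\<in>B. h b \<in> L' \<and> p (h b) = p b \<and> (b \<in> BK \<longrightarrow> h b = b)"
  proof (rule bchoice, rule ballI)
    fix b assume b: "b \<in> B"
    show "\<exists>y. y \<in> L' \<and> p y = p b \<and> (b \<in> BK \<longrightarrow> y = b)"
    proof (cases "b \<in> BK")
      case True
      then show ?thesis using BK(1) ker by (auto simp: K_def)
    next
      case False
      have "p b \<in> p ` L'" using b B(2) p(2) by blast
      then show ?thesis using False by auto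
    qed
  qed
  then obtain h where h: "\<And>b. b \<in> B \<Longrightarrow> h b \<in> L' \<and> p (h b) = p b \<and> (b \<in> BK \<longrightarrow> h b = b)"
    by blast
  obtain G where G: "Vector_Spaces.linear scale scale G" "\<And>b. b \<in> B \<Longrightarrow> G b = h b"
    using pair.linear_independent_extend[OF B(3)] by blast
  interpret G: Vector_Spaces.linear scale scale G by fact
  have pG: "p (G x) = p x" if "x \<in> L" for x
    using pair.linear_eq_on[OF Vector_Spaces.linear_compose[OF G(1) p(1)] p(1), of x B]
      that spanB G(2) h by simp
  have GL: "G ` L \<subseteq> L'"
  proof -
    have "G ` B \<subseteq> L'" using G(2) h by auto
    then show ?thesis
      using span_minimal[OF _ L(2), of "G ` B"] G.span_image[of B] spanB by simp
  qed
  have "inj_on G L"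
    unfolding G.inj_on_iff_eq_0[OF L(1)]
  proof (intro ballI impI)
    fix x assume x: "x \<in> L" "G x = 0"
    then have "x \<in> K" using pG[OF x(1)] by (simp add: K_def p.zero)
    then have "x \<in> span BK" using BK(3) by blast
    then have "G x = x"
    proof (rule pair.linear_eq_on[OF G(1) linear_ident])
      show "G b = b" if "b \<in> BK" for b using that G(2)[of b] h[of b] B(1) by auto
    qed
    then show "x = 0" using x by simp
  qed
  then have "inj_on (F \<circ> G) (span B)"
    using GL F(2) spanB by (metis comp_inj_on inj_on_subset)
  then have surj: "(F \<circ> G) ` L = L"
    using injective_endomorphism_on_span_surj[OF finB B(3) Vector_Spaces.linear_compose[OF G(1) F(1)]]
      GL F(3) spanB by (auto simp: image_subset_iff)
  have "v \<in> G ` L" if v: "v \<in> L'" for v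
  proof -
    have "F v \<in> (F \<circ> G) ` L" using v F(3) surj by auto
    then obtain x where "x \<in> L" "F v = F (G x)" by auto
    then show ?thesis using F(2) v GL by (auto dest: inj_onD)
  qed
  then have "p ` L' \<subseteq> p ` L" using pG by auto
  then show ?thesis using p(2) by blast
qed

end


section \<open>Pairs of square matrices as a vector space of functions\<close>

text \<open>
  The type of all matrices is not a vector space, because addition is meaningful only within one
  size. The pairs of k by k matrices are therefore represented by the functions that assign to
  \<open>(True, i, j)\<close> and \<open>(False, i, j)\<close> the entries of the first and of the second matrix, and that
  vanish outside the index range. Functions into a field form a vector space as a type.
\<close>

interpretation fun_space: vector_space "\<lambda>c f x. c * f x :: 'a::field"
  by unfold_locales (auto simp: fun_eq_iff algebra_simps)

lemma fun_space_linearI: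
  fixes F :: "('i \<Rightarrow> 'a::field) \<Rightarrow> 'i \<Rightarrow> 'a"
  assumes "\<And>f g. F (f + g) = F f + F g" "\<And>c f. F (\<lambda>x. c * f x) = (\<lambda>x. c * F f x)"
  shows "Vector_Spaces.linear (\<lambda>c f x. c * f x) (\<lambda>c f x. c * f x) F"
  unfolding Vector_Spaces.linear_iff
  using assms fun_space.vector_space_axioms by blast

lemma fun_space_span_of_finite_support:
  fixes f :: "'i \<Rightarrow> 'a::field"
  assumes "finite I" "\<And>x. x \<notin> I \<Longrightarrow> f x = 0"
  shows "f \<in> fun_space.span ((\<lambda>x y. if y = x then 1 else 0) ` I)"
  using assms
proof (induction I arbitrary: f rule: finite_induct)
  case empty
  then have "f = 0" by auto
  then show ?case using fun_space.span_zero by (simp add: zero_fun_def)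
next
  case (insert a I)
  let ?e = "\<lambda>x y. if y = x then 1 else (0 :: 'a)"
  have "f(a := 0) \<in> fun_space.span (?e ` I)"
    using insert by auto
  then have "f(a := 0) \<in> fun_space.span (?e ` insert a I)"
    by (rule rev_subsetD) (rule fun_space.span_mono, blast)
  moreover have "(\<lambda>y. f a * ?e a y) \<in> fun_space.span (?e ` insert a I)"
    by (intro fun_space.span_scale fun_space.span_base) blast
  ultimately have "f(a := 0) + (\<lambda>y. f a * ?e a y) \<in> fun_space.span (?e ` insert a I)"
    by (rule fun_space.span_add)
  also have "f(a := 0) + (\<lambda>y. f a * ?e a y) = f"
    by auto
  finally show ?case .
qed

definition component :: "nat \<Rightarrow> bool \<Rightarrow> (bool \<times> nat \<times> nat \<Rightarrow> 'a) \<Rightarrow> 'a mat" where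
  "component k b f = mat k k (\<lambda>ij. f (b, ij))"

definition pair_entries :: "nat \<Rightarrow> 'a::zero mat \<Rightarrow> 'a mat \<Rightarrow> bool \<times> nat \<times> nat \<Rightarrow> 'a" where
  "pair_entries k P Q = (\<lambda>(b, i, j). if i < k \<and> j < k then (if b then P else Q) $$ (i, j) else 0)"

lemma component_carrier [simp]: "component k b f \<in> carrier_mat k k"
  and component_index [simp]: "i < k \<Longrightarrow> j < k \<Longrightarrow> component k b f $$ (i, j) = f (b, i, j)"
  by (auto simp: component_def)

lemma component_entries:
  assumes "P \<in> carrier_mat k k" "Q \<in> carrier_mat k k"
  shows "component k b (pair_entries k P Q) = (if b then P else Q)"
  using assms by (intro eq_matI) (auto simp: component_def pair_entries_def)

lemma component_add: "component k b (f + g) = component k b f + component k b g"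
  by (rule eq_matI) (auto simp: component_def)

lemma component_scale: "component k b (\<lambda>x. c * f x) = c \<cdot>\<^sub>m component k b f"
  by (rule eq_matI) (auto simp: component_def)

lemma component_zero: "component k b 0 = 0\<^sub>m k k"
  by (rule eq_matI) (auto simp: component_def)

lemma pair_entries_add:
  fixes P Q :: "'a::monoid_add mat"
  assumes "P \<in> carrier_mat k k" "Q \<in> carrier_mat k k" "P' \<in> carrier_mat k k" "Q' \<in> carrier_mat k k"
  shows "pair_entries k (P + P') (Q + Q') = pair_entries k P Q + pair_entries k P' Q'"
  using assms by (auto simp: pair_entries_def fun_eq_iff)

lemma pair_entries_scale:
  fixes P Q :: "'a::semiring_0 mat"
  assumes "P \<in> carrier_mat k k" "Q \<in> carrier_mat k k"
  shows "pair_entries k (c \<cdot>\<^sub>m P) (c \<cdot>\<^sub>m Q) = (\<lambda>x. c * pair_entries k P Q x)"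
  using assms by (auto simp: pair_entries_def fun_eq_iff)

section \<open>Intertwiners of two families of matrices\<close>

text \<open>
  The vanishing condition outside the index range makes the pair of matrices determine the function,
  and makes the space finitely generated.
\<close>

definition intertwiners ::
  "nat \<Rightarrow> 'j set \<Rightarrow> ('j \<Rightarrow> 'a::field mat) \<Rightarrow> ('j \<Rightarrow> 'a mat) \<Rightarrow> (bool \<times> nat \<times> nat \<Rightarrow> 'a) set" where
  "intertwiners k J M N = {f. (\<forall>b i j. \<not> (i < k \<and> j < k) \<longrightarrow> f (b, i, j) = 0) \<and>
     (\<forall>t\<in>J. component k True f * M t = N t * component k False f)}"

lemma subspace_intertwiners:
  assumes M: "\<And>t. t \<in> J \<Longrightarrow> M t \<in> carrier_mat k k" and N: "\<And>t. t \<in> J \<Longrightarrow> N t \<in> carrier_mat k k"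
  shows "fun_space.subspace (intertwiners k J M N)"
  unfolding fun_space.subspace_def
proof (intro conjI ballI allI)
  show "0 \<in> intertwiners k J M N"
    using M N by (auto simp: intertwiners_def component_zero
        left_mult_zero_mat[of _ k k] right_mult_zero_mat[of _ k k])
next
  fix f g assume "f \<in> intertwiners k J M N" "g \<in> intertwiners k J M N"
  then show "f + g \<in> intertwiners k J M N"
    using M N by (auto simp: intertwiners_def component_add
        add_mult_distrib_mat[of _ k k _ _ k] mult_add_distrib_mat[of _ k k _ k])
next
  fix c f assume "f \<in> intertwiners k J M N"
  then show "(\<lambda>x. c * f x) \<in> intertwiners k J M N"
    using M N by (auto simp: intertwiners_def component_scale
        mult_smult_assoc_mat[of _ k k _ k] mult_smult_distrib[of _ k k _ k])
qed

lemma intertwiners_subset_span: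
  "intertwiners k J M N \<subseteq>
     fun_space.span ((\<lambda>x y. if y = x then 1 else 0) ` (UNIV \<times> {..<k} \<times> {..<k}))"
proof
  fix f assume "f \<in> intertwiners k J M N"
  then have "f x = 0" if "x \<notin> UNIV \<times> {..<k} \<times> {..<k}" for x
    using that by (cases x) (auto simp: intertwiners_def)
  then show "f \<in> fun_space.span ((\<lambda>x y. if y = x then 1 else 0) ` (UNIV \<times> {..<k} \<times> {..<k}))"
    by (intro fun_space_span_of_finite_support) auto
qed

lemma pair_entries_in_intertwiners_iff:
  assumes "P \<in> carrier_mat k k" "Q \<in> carrier_mat k k"
  shows "pair_entries k P Q \<in> intertwiners k J M N \<longleftrightarrow> (\<forall>t\<in>J. P * M t = N t * Q)"
  using assms by (auto simp: intertwiners_def component_entries) (auto simp: pair_entries_def)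

lemma intertwiners_eqI:
  assumes "f \<in> intertwiners k J M N" "g \<in> intertwiners k J M N"
    and eq: "\<And>b. component k b f = component k b g"
  shows "f = g"
proof
  fix x :: "bool \<times> nat \<times> nat"
  obtain b i j where x: "x = (b, i, j)" by (cases x) auto
  show "f x = g x"
  proof (cases "i < k \<and> j < k")
    case True
    then show ?thesis using arg_cong[OF eq, of "\<lambda>X. X $$ (i, j)" b] by (simp add: x)
  next
    case False
    then show ?thesis using assms(1,2) by (auto simp: intertwiners_def x)
  qed
qed

lemma index_mult_mat_sum:
  assumes "P \<in> carrier_mat k k" "Q \<in> carrier_mat k k" "i < k" "j < k"
  shows "(P * Q) $$ (i, j) = (\<Sum>c<k. P $$ (i, c) * Q $$ (c, j))"
  using assms by (auto simp: scalar_prod_def atLeast0LessThan)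

lemma mult_eq_of_zero_columns:
  fixes P :: "'a::semiring_0 mat"
  assumes carr: "P \<in> carrier_mat k k" "M \<in> carrier_mat k k" "N \<in> carrier_mat k k"
    and P0: "\<And>i c. i < k \<Longrightarrow> c < m \<Longrightarrow> c < k \<Longrightarrow> P $$ (i, c) = 0"
    and MN: "\<And>c j. c < k \<Longrightarrow> j < k \<Longrightarrow> m \<le> c \<Longrightarrow> M $$ (c, j) = N $$ (c, j)"
  shows "P * M = P * N"
proof (rule eq_matI)
  fix i j assume "i < dim_row (P * N)" "j < dim_col (P * N)"
  then have ij: "i < k" "j < k" using carr by auto
  have "P $$ (i, c) * M $$ (c, j) = P $$ (i, c) * N $$ (c, j)" if "c < k" for c
    using P0[of i c] MN[of c j] that ij by (cases "c < m") auto
  then show "(P * M) $$ (i, j) = (P * N) $$ (i, j)"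
    using carr ij by (simp add: index_mult_mat_sum del: index_mult_mat)
qed (use carr in auto)

text \<open>
  The hypotheses say that \<open>M t\<close> and \<open>N t\<close> differ only in the top left m by m block and that both
  diagonal blocks of \<open>N t\<close> vanish. With p the projection to the first m columns of P and F the
  substitution (P, Q) \<mapsto> (P S, Q T\<inverse>), \<open>fun_space.image_eq_of_same_kernel\<close> applies to the intertwiners
  of M and N and those of N and N, and the pair (I, I) of the latter has a counterpart among the
  former.
\<close>

lemma intertwiner_with_unit_columns:
  fixes M N :: "'j \<Rightarrow> 'a::field mat"
  assumes M: "\<And>t. t \<in> J \<Longrightarrow> M t \<in> carrier_mat k k" and N: "\<And>t. t \<in> J \<Longrightarrow> N t \<in> carrier_mat k k"
    and S: "S \<in> carrier_mat k k" "S' \<in> carrier_mat k k" "S * S' = 1\<^sub>m k"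
    and T: "T \<in> carrier_mat k k" "T' \<in> carrier_mat k k" "T * T' = 1\<^sub>m k" "T' * T = 1\<^sub>m k"
    and equiv: "\<And>t. t \<in> J \<Longrightarrow> S * M t * T = N t"
    and MN: "\<And>t i j. t \<in> J \<Longrightarrow> i < k \<Longrightarrow> j < k \<Longrightarrow> m \<le> i \<or> m \<le> j \<Longrightarrow> M t $$ (i, j) = N t $$ (i, j)"
    and N0: "\<And>t i j. t \<in> J \<Longrightarrow> i < k \<Longrightarrow> j < k \<Longrightarrow> i < m \<longleftrightarrow> j < m \<Longrightarrow> N t $$ (i, j) = 0"
  shows "\<exists>P\<in>carrier_mat k k. \<exists>Q\<in>carrier_mat k k.
    (\<forall>i<k. \<forall>j<k. j < m \<longrightarrow> P $$ (i, j) = 1\<^sub>m k $$ (i, j)) \<and> (\<forall>t\<in>J. P * M t = N t * Q)"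
proof -
  let ?L = "intertwiners k J M N" and ?L' = "intertwiners k J N N"
  define p :: "(bool \<times> nat \<times> nat \<Rightarrow> 'a) \<Rightarrow> bool \<times> nat \<times> nat \<Rightarrow> 'a"
    where "p f = (\<lambda>(b, i, j). if b \<and> i < k \<and> j < k \<and> j < m then f (b, i, j) else 0)" for f
  define F :: "(bool \<times> nat \<times> nat \<Rightarrow> 'a) \<Rightarrow> bool \<times> nat \<times> nat \<Rightarrow> 'a"
    where "F f = pair_entries k (component k True f * S) (component k False f * T')" for f
  have carrF: "component k True f * S \<in> carrier_mat k k" "component k False f * T' \<in> carrier_mat k k"
    for f :: "bool \<times> nat \<times> nat \<Rightarrow> 'a"
    using S T by (auto intro!: mult_carrier_mat)
  have "p ` ?L = p ` ?L'"
  proof (rule fun_space.image_eq_of_same_kernel)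
    show "fun_space.subspace ?L" "fun_space.subspace ?L'"
      using M N by (auto intro: subspace_intertwiners)
    show "?L \<subseteq> fun_space.span ((\<lambda>x y. if y = x then 1 else 0) ` (UNIV \<times> {..<k} \<times> {..<k}))"
      by (rule intertwiners_subset_span)
    show "finite ((\<lambda>x y. if y = x then 1 else (0::'a)) ` (UNIV \<times> {..<k} \<times> {..<k} :: (bool \<times> nat \<times> nat) set))"
      by simp
    show "Vector_Spaces.linear (\<lambda>c f x. c * f x) (\<lambda>c f x. c * f x) p"
      by (rule fun_space_linearI) (auto simp: p_def fun_eq_iff)
    show "p ` ?L \<subseteq> p ` ?L'"
    proof (rule image_subsetI)
      fix f assume f: "f \<in> ?L"
      \<comment> \<open>Only the last columns of the equation for \<open>f\<close> survive this truncation, and they do not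
        involve the top left block of \<open>M t\<close>. In the first columns both sides become 0.\<close>
      define P where "P = mat k k (\<lambda>(i, j). if j < m then f (True, i, j) else 0)"
      define Q where "Q = mat k k (\<lambda>(i, j). if j < m then 0 else f (False, i, j))"
      have carr: "P \<in> carrier_mat k k" "Q \<in> carrier_mat k k"
        by (auto simp: P_def Q_def)
      have P: "P $$ (i, j) = (if j < m then f (True, i, j) else 0)"
        and Q: "Q $$ (i, j) = (if j < m then 0 else f (False, i, j))" if "i < k" "j < k" for i j
        using that by (auto simp: P_def Q_def)
      have "P * N t = N t * Q" if t: "t \<in> J" for t
      proof (rule eq_matI)
        fix i j assume "i < dim_row (N t * Q)" "j < dim_col (N t * Q)"
        then have ij: "i < k" "j < k" using N[OF t] carr by auto
        show "(P * N t) $$ (i, j) = (N t * Q) $$ (i, j)"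
        proof (cases "j < m")
          case True
          have "(P * N t) $$ (i, j) = 0"
            using N0[OF t] ij True N[OF t] carr
            by (auto simp: index_mult_mat_sum[of _ k] P simp del: index_mult_mat intro!: sum.neutral)
          moreover have "(N t * Q) $$ (i, j) = 0"
            using ij True N[OF t] carr
            by (auto simp: index_mult_mat_sum[of _ k] Q simp del: index_mult_mat intro!: sum.neutral)
          ultimately show ?thesis by simp
        next
          case False
          have "(P * N t) $$ (i, j) = (component k True f * M t) $$ (i, j)"
            using N0[OF t] MN[OF t] ij False N[OF t] M[OF t] carr
            by (auto simp: index_mult_mat_sum[of _ k] P simp del: index_mult_mat intro!: sum.cong)
          also have "\<dots> = (N t * component k False f) $$ (i, j)"
            using f t by (simp add: intertwiners_def del: index_mult_mat)
          also have "\<dots> = (N t * Q) $$ (i, j)"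
            using ij False N[OF t] carr
            by (auto simp: index_mult_mat_sum[of _ k] Q simp del: index_mult_mat intro!: sum.cong)
          finally show ?thesis .
        qed
      qed (use N[OF t] carr in auto)
      then have "pair_entries k P Q \<in> ?L'"
        using carr by (simp add: pair_entries_in_intertwiners_iff)
      moreover have "p (pair_entries k P Q) = p f"
        by (auto simp: p_def pair_entries_def P_def fun_eq_iff)
      ultimately show "p f \<in> p ` ?L'" by (metis image_eqI)
    qed
    fix f assume pf: "p f = 0"
    have "f (True, i, c) = 0" if "i < k" "c < k" "c < m" for i c
      using fun_cong[OF pf, of "(True, i, c)"] that by (simp add: p_def)
    then have "component k True f * M t = component k True f * N t" if "t \<in> J" for t
      using that M N MN by (intro mult_eq_of_zero_columns[where m = m]) auto
    then show "f \<in> ?L \<longleftrightarrow> f \<in> ?L'"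
      by (auto simp: intertwiners_def)
  next
    show "Vector_Spaces.linear (\<lambda>c f x. c * f x) (\<lambda>c f x. c * f x) F"
      using S T carrF by (intro fun_space_linearI)
        (auto simp: F_def component_add component_scale
          pair_entries_add[symmetric] pair_entries_scale[symmetric]
          add_mult_distrib_mat[of _ k k _ _ k] mult_smult_assoc_mat[of _ k k _ k])
    show "F ` ?L' \<subseteq> ?L"
    proof (rule image_subsetI)
      fix f assume f: "f \<in> ?L'"
      define P Q where "P = component k True f" and "Q = component k False f"
      have carr: "P \<in> carrier_mat k k" "Q \<in> carrier_mat k k" by (auto simp: P_def Q_def)
      have "P * S * M t = N t * (Q * T')" if t: "t \<in> J" for t
      proof -
        note c = carr S(1) T(1,2) M[OF t] N[OF t]
        have "P * S * M t = P * (S * M t * T) * T'"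
          using c T(3) by (simp add: assoc_mult_mat[of _ k k _ k _ k]
              right_mult_one_mat[of _ k k] mult_carrier_mat[of _ k k])
        also have "\<dots> = N t * Q * T'"
          using f t by (simp add: equiv intertwiners_def P_def Q_def)
        finally show ?thesis using c by (simp add: assoc_mult_mat[of _ k k _ k _ k])
      qed
      then show "F f \<in> ?L"
        using carrF by (simp add: F_def pair_entries_in_intertwiners_iff P_def Q_def)
    qed
    show "inj_on F ?L'"
    proof (rule inj_onI)
      fix f g assume fg: "f \<in> ?L'" "g \<in> ?L'" "F f = F g"
      have "component k True f * S = component k True g * S"
        "component k False f * T' = component k False g * T'"
        using arg_cong[OF fg(3), of "component k True"] arg_cong[OF fg(3), of "component k False"] carrF
        by (simp_all add: F_def component_entries)
      then have "component k True f * S * S' = component k True g * S * S'"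
        "component k False f * T' * T = component k False g * T' * T"
        by simp_all
      then have "component k True f = component k True g" "component k False f = component k False g"
        using S T by (simp_all add: assoc_mult_mat[of _ k k _ k _ k] right_mult_one_mat[of _ k k])
      then have "component k b f = component k b g" for b by (cases b) auto
      then show "f = g" using intertwiners_eqI fg by blast
    qed
  qed
  moreover have "pair_entries k (1\<^sub>m k) (1\<^sub>m k) \<in> ?L'"
    using N by (auto simp: pair_entries_in_intertwiners_iff
        left_mult_one_mat[of _ k k] right_mult_one_mat[of _ k k])
  ultimately obtain f where f: "f \<in> ?L" "p f = p (pair_entries k (1\<^sub>m k) (1\<^sub>m k))"
    by (metis imageE imageI)
  have "component k True f $$ (i, j) = 1\<^sub>m k $$ (i, j)" if "i < k" "j < k" "j < m" for i j
    using fun_cong[OF f(2), of "(True, i, j)"] that by (simp add: p_def pair_entries_def)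
  moreover have "component k True f * M t = N t * component k False f" if "t \<in> J" for t
    using f(1) that by (simp add: intertwiners_def)
  ultimately show ?thesis
    by (intro bexI[of _ "component k True f"] bexI[of _ "component k False f"] conjI allI ballI impI)
      simp_all
qed

section \<open>Equivalence and Sylvester equations\<close>

lemma sum_lessThan_add:
  fixes m n :: nat
  shows "(\<Sum>c<m + n. f c) = (\<Sum>c<m. f c) + (\<Sum>c<n. f (m + c) :: 'a::comm_monoid_add)"
  by (induction n) (simp_all add: add.assoc)

lemma invertible_matE:
  assumes "invertible_mat S" "S \<in> carrier_mat k k"
  obtains S' where "S' \<in> carrier_mat k k" "S * S' = 1\<^sub>m k" "S' * S = 1\<^sub>m k"
proof -
  obtain S' where S': "S * S' = 1\<^sub>m k" "S' * S = 1\<^sub>m (dim_row S')"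
    using assms by (auto simp: invertible_mat_def inverts_mat_def)
  have "dim_col S' = k" using arg_cong[OF S'(1), of dim_col] by simp
  moreover have "dim_row S' = k" using arg_cong[OF S'(2), of dim_col] assms(2) by simp
  ultimately show ?thesis using that S' by auto
qed

lemma invertible_matI:
  assumes "S \<in> carrier_mat k k" "S' \<in> carrier_mat k k" "S * S' = 1\<^sub>m k" "S' * S = 1\<^sub>m k"
  shows "invertible_mat S"
  unfolding invertible_mat_def inverts_mat_def
proof (intro conjI exI[of _ S'])
  show "square_mat S" using assms(1) by simp
  show "S * S' = 1\<^sub>m (dim_row S)" "S' * S = 1\<^sub>m (dim_row S')"
    using assms by (simp_all only: carrier_matD)
qed

text \<open>
  The nontrivial half of Roth's theorem for a system of Sylvester equations over an arbitrary index
  set, with independent unknowns Y and Z. In the top left block of P M = N Q, the unit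
  columns of P contribute C, and the rest contributes Z B and A Y.
\<close>

lemma Sylvester_solvable_if_equivalent:
  fixes A B C :: "'j \<Rightarrow> 'a::field mat"
  assumes carr: "\<And>t. t \<in> J \<Longrightarrow> A t \<in> carrier_mat m n" "\<And>t. t \<in> J \<Longrightarrow> B t \<in> carrier_mat n m"
      "\<And>t. t \<in> J \<Longrightarrow> C t \<in> carrier_mat m m"
    and S: "S \<in> carrier_mat (m + n) (m + n)" "invertible_mat S"
    and T: "T \<in> carrier_mat (m + n) (m + n)" "invertible_mat T"
    and equiv: "\<And>t. t \<in> J \<Longrightarrow> S * four_block_mat (C t) (- A t) (B t) (0\<^sub>m n n) * T
        = four_block_mat (0\<^sub>m m m) (- A t) (B t) (0\<^sub>m n n)"
  shows "\<exists>Y\<in>carrier_mat n m. \<exists>Z\<in>carrier_mat m n. \<forall>t\<in>J. A t * Y - Z * B t = C t"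
proof -
  define M where "M t = four_block_mat (C t) (- A t) (B t) (0\<^sub>m n n)" for t
  define N where "N t = four_block_mat (0\<^sub>m m m) (- A t) (B t) (0\<^sub>m n n)" for t
  obtain S' where S': "S' \<in> carrier_mat (m + n) (m + n)" "S * S' = 1\<^sub>m (m + n)"
    using invertible_matE S by metis
  obtain T' where T': "T' \<in> carrier_mat (m + n) (m + n)" "T * T' = 1\<^sub>m (m + n)" "T' * T = 1\<^sub>m (m + n)"
    using invertible_matE T by metis
  have M: "M t \<in> carrier_mat (m + n) (m + n)" and N: "N t \<in> carrier_mat (m + n) (m + n)"
    if "t \<in> J" for t
    using carr[OF that] by (auto simp: M_def N_def)
  have MN: "M t $$ (i, j) = N t $$ (i, j)"
    if "t \<in> J" "i < m + n" "j < m + n" "m \<le> i \<or> m \<le> j" for t i j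
    using carr[OF that(1)] that(2-) by (auto simp: M_def N_def)
  have N0: "N t $$ (i, j) = 0"
    if "t \<in> J" "i < m + n" "j < m + n" "i < m \<longleftrightarrow> j < m" for t i j
    using carr[OF that(1)] that(2-) by (auto simp: N_def)
  have equiv': "S * M t * T = N t" if "t \<in> J" for t
    using equiv[OF that] by (simp only: M_def N_def)
  have "\<exists>P\<in>carrier_mat (m + n) (m + n). \<exists>Q\<in>carrier_mat (m + n) (m + n).
      (\<forall>i<m + n. \<forall>j<m + n. j < m \<longrightarrow> P $$ (i, j) = 1\<^sub>m (m + n) $$ (i, j)) \<and>
      (\<forall>t\<in>J. P * M t = N t * Q)"
    by (rule intertwiner_with_unit_columns[where S = S and S' = S' and T = T and T' = T'])
      (fact M N S(1) S' T(1) T' equiv' MN N0)+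
  then obtain P Q where PQ: "P \<in> carrier_mat (m + n) (m + n)" "Q \<in> carrier_mat (m + n) (m + n)"
    and unit: "\<forall>i<m + n. \<forall>j<m + n. j < m \<longrightarrow> P $$ (i, j) = 1\<^sub>m (m + n) $$ (i, j)"
    and PM: "\<forall>t\<in>J. P * M t = N t * Q"
    by (elim bexE conjE)
  define Z where "Z = mat m n (\<lambda>(i, j). P $$ (i, m + j))"
  define Y where "Y = mat n m (\<lambda>(i, j). - Q $$ (m + i, j))"
  have ZY: "Z \<in> carrier_mat m n" "Y \<in> carrier_mat n m"
    by (auto simp: Z_def Y_def)
  have "A t * Y - Z * B t = C t" if t: "t \<in> J" for t
  proof (rule eq_matI)
    note c = carr[OF t]
    fix i j assume "i < dim_row (C t)" "j < dim_col (C t)"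
    then have ij: "i < m" "j < m" using c by auto
    have "C t $$ (i, j) + (Z * B t) $$ (i, j) = (P * M t) $$ (i, j)"
    proof -
      have "(\<Sum>c<m. P $$ (i, c) * M t $$ (c, j)) = (\<Sum>c<m. if c = i then C t $$ (i, j) else 0)"
        using ij c unit by (intro sum.cong) (auto simp: M_def)
      also have "\<dots> = C t $$ (i, j)"
        using ij by simp
      finally have "(\<Sum>c<m. P $$ (i, c) * M t $$ (c, j)) = C t $$ (i, j)" .
      moreover have "(\<Sum>c<n. P $$ (i, m + c) * M t $$ (m + c, j)) = (Z * B t) $$ (i, j)"
        using ij c by (auto simp: M_def Z_def scalar_prod_def atLeast0LessThan intro!: sum.cong)
      ultimately show ?thesis
        using index_mult_mat_sum[OF PQ(1) M[OF t], of i j] ij by (simp add: sum_lessThan_add)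
    qed
    also have "\<dots> = (N t * Q) $$ (i, j)"
      using PM t by simp
    also have "\<dots> = (A t * Y) $$ (i, j)"
    proof -
      have "(\<Sum>c<m. N t $$ (i, c) * Q $$ (c, j)) = 0"
        using ij c by (intro sum.neutral) (auto simp: N_def)
      moreover have "(\<Sum>c<n. N t $$ (i, m + c) * Q $$ (m + c, j)) = (A t * Y) $$ (i, j)"
        using ij c by (auto simp: N_def Y_def scalar_prod_def atLeast0LessThan intro!: sum.cong)
      ultimately show ?thesis
        using index_mult_mat_sum[OF N[OF t] PQ(2), of i j] ij by (simp add: sum_lessThan_add)
    qed
    finally have "(A t * Y) $$ (i, j) - (Z * B t) $$ (i, j) = C t $$ (i, j)"
      by (simp add: algebra_simps)
    then show "(A t * Y - Z * B t) $$ (i, j) = C t $$ (i, j)"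
      using ij c ZY by simp
  qed (use carr[OF t] ZY in auto)
  then show ?thesis
    by (intro bexI[OF _ ZY(2)] bexI[OF _ ZY(1)] ballI)
qed

section \<open>Matrix involutions induced by field involutions\<close>

locale field_involution = field_hom \<sigma> for \<sigma> :: "'a::field \<Rightarrow> 'a" +
  assumes involutive [simp]: "\<sigma> (\<sigma> x) = x"
begin

definition star :: "'a mat \<Rightarrow> 'a mat" where
  "star M = map_mat \<sigma> (transpose_mat M)"

lemma star_carrier [simp]: "M \<in> carrier_mat r c \<Longrightarrow> star M \<in> carrier_mat c r"
  by (auto simp: star_def)

lemma star_dim [simp]: "dim_row (star M) = dim_col M" "dim_col (star M) = dim_row M"
  by (auto simp: star_def)

lemma star_index [simp]: "i < dim_col M \<Longrightarrow> j < dim_row M \<Longrightarrow> star M $$ (i, j) = \<sigma> (M $$ (j, i))"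
  by (simp add: star_def)

lemma star_star [simp]: "star (star M) = M"
  by (rule eq_matI) auto

lemma star_mult:
  assumes "P \<in> carrier_mat r k" "Q \<in> carrier_mat k c"
  shows "star (P * Q) = star Q * star P"
  unfolding star_def transpose_mult[OF assms]
  using assms by (intro mat_hom_mult) auto

lemma star_uminus: "star (- M) = - star M"
  by (rule eq_matI) (auto simp: hom_uminus)

lemma star_minus:
  assumes "P \<in> carrier_mat r c" "Q \<in> carrier_mat r c"
  shows "star (P - Q) = star P - star Q"
  using assms by (intro eq_matI) (auto simp: hom_minus)

lemma star_one: "star (1\<^sub>m k) = 1\<^sub>m k"
  by (rule eq_matI) auto

lemma star_zero: "star (0\<^sub>m r c) = 0\<^sub>m c r"
  by (rule eq_matI) auto

lemma star_four_block:
  assumes "P \<in> carrier_mat r1 c1" "Q \<in> carrier_mat r1 c2" "R \<in> carrier_mat r2 c1" "T \<in> carrier_mat r2 c2"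
  shows "star (four_block_mat P Q R T) = four_block_mat (star P) (star R) (star Q) (star T)"
  using assms by (intro eq_matI) auto

lemma invertible_star:
  assumes "S \<in> carrier_mat k k" "invertible_mat S"
  shows "invertible_mat (star S)"
proof -
  obtain S' where S': "S' \<in> carrier_mat k k" "S * S' = 1\<^sub>m k" "S' * S = 1\<^sub>m k"
    using invertible_matE assms by metis
  have "star S * star S' = 1\<^sub>m k"
    using star_mult[OF S'(1) assms(1)] unfolding S'(3) star_one by simp
  moreover have "star S' * star S = 1\<^sub>m k"
    using star_mult[OF assms(1) S'(1)] unfolding S'(2) star_one by simp
  ultimately show ?thesis
    using assms(1) S'(1) by (intro invertible_matI[of "star S" k "star S'"] star_carrier)
qed

section \<open>Star-Sylvester equations and star-congruence\<close>

lemma congruent_if_star_Sylvester: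
  assumes carr: "A \<in> carrier_mat m n" "B \<in> carrier_mat n m" "C \<in> carrier_mat m m"
    and X: "X \<in> carrier_mat n m" "A * X - star X * B = C"
  defines "S \<equiv> four_block_mat (1\<^sub>m m) (star X) (0\<^sub>m n m) (1\<^sub>m n)"
  shows "S * four_block_mat C (- A) B (0\<^sub>m n n) * star S = four_block_mat (0\<^sub>m m m) (- A) B (0\<^sub>m n n)"
proof -
  have sX: "star X \<in> carrier_mat m n" using X(1) by simp
  have BX: "star X * B \<in> carrier_mat m m"
    using carr sX by auto
  have star_S: "star S = four_block_mat (1\<^sub>m m) (0\<^sub>m m n) X (1\<^sub>m n)"
    unfolding S_def using X(1)
    by (subst star_four_block[of _ m m _ n _ n]) (auto simp: star_one star_zero)
  have left: "S * four_block_mat C (- A) B (0\<^sub>m n n) = four_block_mat (C + star X * B) (- A) B (0\<^sub>m n n)"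
    unfolding S_def using carr X(1) sX
    by (subst mult_four_block_mat[of _ m m _ n _ n _ _ m _ n]) auto
  have zero: "C + star X * B + - (A * X) = 0\<^sub>m m m"
  proof (rule eq_matI)
    fix i j assume "i < dim_row (0\<^sub>m m m :: 'a mat)" "j < dim_col (0\<^sub>m m m :: 'a mat)"
    then have ij: "i < m" "j < m" by auto
    have "C $$ (i, j) = (A * X) $$ (i, j) - (star X * B) $$ (i, j)"
      using arg_cong[OF X(2), of "\<lambda>W. W $$ (i, j)"] ij carr X(1)
      by (auto simp del: index_mult_mat(1))
    then show "(C + star X * B + - (A * X)) $$ (i, j) = 0\<^sub>m m m $$ (i, j)"
      using ij carr X(1) by (simp del: index_mult_mat(1))
  qed (use carr X(1) in auto)
  have "four_block_mat (C + star X * B) (- A) B (0\<^sub>m n n) * four_block_mat (1\<^sub>m m) (0\<^sub>m m n) X (1\<^sub>m n)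
      = four_block_mat ((C + star X * B) * 1\<^sub>m m + - A * X) ((C + star X * B) * 0\<^sub>m m n + - A * 1\<^sub>m n)
          (B * 1\<^sub>m m + 0\<^sub>m n n * X) (B * 0\<^sub>m m n + 0\<^sub>m n n * 1\<^sub>m n)"
    using carr X(1) BX by (intro mult_four_block_mat[of _ m m _ n _ n _ _ m _ n]) auto
  also have "\<dots> = four_block_mat (0\<^sub>m m m) (- A) B (0\<^sub>m n n)"
  proof (rule cong_four_block_mat)
    have "(C + star X * B) * 1\<^sub>m m = C + star X * B"
      using carr(3) BX by (intro right_mult_one_mat[of _ m m]) auto
    then show "(C + star X * B) * 1\<^sub>m m + - A * X = 0\<^sub>m m m"
      using zero carr X(1) by simp
    show "(C + star X * B) * 0\<^sub>m m n + - A * 1\<^sub>m n = - A"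
      using carr X(1) BX by (simp add: right_mult_zero_mat[of _ m m])
    show "B * 1\<^sub>m m + 0\<^sub>m n n * X = B"
      using carr X(1) by simp
    show "B * 0\<^sub>m m n + 0\<^sub>m n n * 1\<^sub>m n = 0\<^sub>m n n"
      using carr by simp
  qed
  finally show ?thesis
    unfolding left star_S .
qed

lemma invertible_unitriangular:
  fixes Z :: "'a mat"
  assumes "Z \<in> carrier_mat m n"
  shows "invertible_mat (four_block_mat (1\<^sub>m m) Z (0\<^sub>m n m) (1\<^sub>m n))"
proof -
  let ?T = "\<lambda>U. four_block_mat (1\<^sub>m m) U (0\<^sub>m n m) (1\<^sub>m n) :: 'a mat"
  have inv: "?T U * ?T (- U) = 1\<^sub>m (m + n)" if U: "U \<in> carrier_mat m n" for U
  proof -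
    have "- 0\<^sub>m n n + 1\<^sub>m n = (1\<^sub>m n :: 'a mat)" by (rule eq_matI) auto
    then show ?thesis
      using U by (subst mult_four_block_mat[of _ m m _ n _ n _ _ m _ n]) auto
  qed
  have "- (- Z) = Z" by (rule eq_matI) auto
  then have "?T (- Z) * ?T Z = 1\<^sub>m (m + n)"
    using inv[of "- Z"] assms by simp
  then show ?thesis
    using inv[OF assms] by (intro invertible_matI[of _ "m + n" "?T (- Z)"]) simp_all
qed

text \<open>
  The congruence by S transforms both \<open>M i\<close> and its star. The latter has the same block shape,
  with \<open>- star (B i)\<close> and \<open>- star (A i)\<close> in the roles of \<open>A i\<close> and \<open>B i\<close>. The system of the
  Sylvester equations for both families has a common solution (Y, Z), and the symmetrisation of
  this solution solves the star-Sylvester system.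
\<close>

lemma star_Sylvester_if_star_congruent:
  assumes two: "(2 :: 'a) \<noteq> 0"
    and carr: "\<And>i. i \<in> I \<Longrightarrow> A i \<in> carrier_mat m n" "\<And>i. i \<in> I \<Longrightarrow> B i \<in> carrier_mat n m"
      "\<And>i. i \<in> I \<Longrightarrow> C i \<in> carrier_mat m m"
    and S: "S \<in> carrier_mat (m + n) (m + n)" "invertible_mat S"
    and congr: "\<And>i. i \<in> I \<Longrightarrow> S * four_block_mat (C i) (- A i) (B i) (0\<^sub>m n n) * star S
        = four_block_mat (0\<^sub>m m m) (- A i) (B i) (0\<^sub>m n n)"
  shows "\<exists>X\<in>carrier_mat n m. \<forall>i\<in>I. A i * X - star X * B i = C i"
proof -
  define J where "J = I \<times> (UNIV :: bool set)"
  define A' where "A' = (\<lambda>(i, b). if b then A i else - star (B i))"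
  define B' where "B' = (\<lambda>(i, b). if b then B i else - star (A i))"
  define C' where "C' = (\<lambda>(i, b). if b then C i else star (C i))"
  have carr': "A' t \<in> carrier_mat m n" "B' t \<in> carrier_mat n m" "C' t \<in> carrier_mat m m"
    if "t \<in> J" for t
    using that carr by (auto simp: J_def A'_def B'_def C'_def)
  have sS: "star S \<in> carrier_mat (m + n) (m + n)" using S by simp
  have "S * four_block_mat (C' t) (- A' t) (B' t) (0\<^sub>m n n) * star S
      = four_block_mat (0\<^sub>m m m) (- A' t) (B' t) (0\<^sub>m n n)" if t: "t \<in> J" for t
  proof (cases t)
    case (Pair i b)
    with t have i: "i \<in> I" by (simp add: J_def)
    note c = carr[OF i]
    show ?thesis
    proof (cases b)
      case True
      then show ?thesis using congr[OF i] Pair by (simp add: A'_def B'_def C'_def)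
    next
      case False
      let ?M = "four_block_mat (C i) (- A i) (B i) (0\<^sub>m n n)"
      let ?N = "four_block_mat (0\<^sub>m m m) (- A i) (B i) (0\<^sub>m n n)"
      have M: "?M \<in> carrier_mat (m + n) (m + n)" using c by simp
      have "star (S * ?M * star S) = S * star ?M * star S"
        using S sS M by (simp add: star_mult[of _ "m + n" "m + n" _ "m + n"]
            assoc_mult_mat[of _ "m + n" "m + n" _ "m + n" _ "m + n"])
      moreover have "star ?M = four_block_mat (C' t) (- A' t) (B' t) (0\<^sub>m n n)"
        using c Pair False by (subst star_four_block[of _ m m _ n _ n])
          (auto simp: A'_def B'_def C'_def star_uminus star_zero)
      moreover have "star ?N = four_block_mat (0\<^sub>m m m) (- A' t) (B' t) (0\<^sub>m n n)"
        using c Pair False by (subst star_four_block[of _ m m _ n _ n])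
          (auto simp: A'_def B'_def star_uminus star_zero)
      ultimately show ?thesis using congr[OF i] by simp
    qed
  qed
  note equiv = this
  have "\<exists>Y\<in>carrier_mat n m. \<exists>Z\<in>carrier_mat m n. \<forall>t\<in>J. A' t * Y - Z * B' t = C' t"
    by (rule Sylvester_solvable_if_equivalent[where S = S and T = "star S"])
      (fact carr' S sS invertible_star[OF S] equiv)+
  then obtain Y Z where YZ: "Y \<in> carrier_mat n m" "Z \<in> carrier_mat m n"
    and sol: "\<forall>t\<in>J. A' t * Y - Z * B' t = C' t"
    by (elim bexE)
  define X where "X = inverse 2 \<cdot>\<^sub>m (Y + star Z)"
  have X: "X \<in> carrier_mat n m" using YZ by (simp add: X_def)
  have two': "\<sigma> 2 = 2" using hom_add[of 1 1] by simp
  have average: "\<sigma> (inverse 2 * (y + \<sigma> z)) = inverse 2 * (z + \<sigma> y)" for y z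
    by (simp only: hom_mult hom_inverse two' hom_add involutive add.commute[of z])
  have starX: "star X = inverse 2 \<cdot>\<^sub>m (Z + star Y)"
  proof (rule eq_matI)
    fix i j assume "i < dim_row (inverse 2 \<cdot>\<^sub>m (Z + star Y))" "j < dim_col (inverse 2 \<cdot>\<^sub>m (Z + star Y))"
    then have ij: "i < m" "j < n" using YZ by auto
    have "star X $$ (i, j) = \<sigma> (inverse 2 * (Y $$ (j, i) + \<sigma> (Z $$ (i, j))))"
      using YZ ij by (simp add: X_def)
    also have "\<dots> = (inverse 2 \<cdot>\<^sub>m (Z + star Y)) $$ (i, j)"
      unfolding average using YZ ij by simp
    finally show "star X $$ (i, j) = (inverse 2 \<cdot>\<^sub>m (Z + star Y)) $$ (i, j)" .
  qed (use YZ X in auto)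
  have "A i * X - star X * B i = C i" if i: "i \<in> I" for i
  proof -
    note c = carr[OF i]
    have sYZ: "star Y \<in> carrier_mat m n" "star Z \<in> carrier_mat n m" using YZ by auto
    have eq1: "A i * Y - Z * B i = C i"
      using bspec[OF sol, of "(i, True)"] i by (simp add: J_def A'_def B'_def C'_def)
    have "- star (B i) * Y - Z * - star (A i) = star (C i)"
      using bspec[OF sol, of "(i, False)"] i by (simp add: J_def A'_def B'_def C'_def)
    then have "star (- star (B i) * Y - Z * - star (A i)) = C i"
      by simp
    moreover have "star (- star (B i) * Y) = star Y * - B i"
      using c YZ by (subst star_mult[of _ m n _ m]) (auto simp: star_uminus)
    moreover have "star (Z * - star (A i)) = (- A i) * star Z"
      using c YZ by (subst star_mult[of _ m n _ m]) (auto simp: star_uminus)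
    moreover have "star (- star (B i) * Y - Z * - star (A i))
        = star (- star (B i) * Y) - star (Z * - star (A i))"
      using c YZ by (intro star_minus[of _ m m]) auto
    ultimately have eq2: "star Y * - B i - (- A i) * star Z = C i" by simp
    have AX: "A i * X = inverse 2 \<cdot>\<^sub>m (A i * Y + A i * star Z)"
      unfolding X_def using c YZ sYZ
      by (simp add: mult_smult_distrib[of _ m n _ m] mult_add_distrib_mat[of _ m n _ m])
    have XB: "star X * B i = inverse 2 \<cdot>\<^sub>m (Z * B i + star Y * B i)"
      unfolding starX using c YZ sYZ
      by (simp add: mult_smult_assoc_mat[of _ m n _ m] add_mult_distrib_mat[of _ m n _ _ m])
    show ?thesis
    proof (rule eq_matI)
      fix r s assume "r < dim_row (C i)" "s < dim_col (C i)"
      then have rs: "r < m" "s < m" using c by auto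
      have e1: "(A i * Y) $$ (r, s) - (Z * B i) $$ (r, s) = C i $$ (r, s)"
        using arg_cong[OF eq1, of "\<lambda>W. W $$ (r, s)"] rs c YZ by simp
      have e2: "(A i * star Z) $$ (r, s) - (star Y * B i) $$ (r, s) = C i $$ (r, s)"
        using arg_cong[OF eq2, of "\<lambda>W. W $$ (r, s)"] rs c YZ sYZ by simp
      have "(A i * X - star X * B i) $$ (r, s)
          = inverse 2 * (((A i * Y) $$ (r, s) - (Z * B i) $$ (r, s))
              + ((A i * star Z) $$ (r, s) - (star Y * B i) $$ (r, s)))"
        unfolding AX XB using rs c YZ sYZ by (simp add: algebra_simps del: index_mult_mat(1))
      also have "\<dots> = C i $$ (r, s)"
        unfolding e1 e2 using two by (simp add: field_simps)
      finally show "(A i * X - star X * B i) $$ (r, s) = C i $$ (r, s)" .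
    qed (use c X in auto)
  qed
  then show ?thesis
    by (intro bexI[OF _ X] ballI)
qed

lemma star_Sylvester_solvable_iff_star_congruent:
  assumes "(2 :: 'a) \<noteq> 0"
    and carr: "\<forall>i\<in>{1..l}. A i \<in> carrier_mat m n \<and> B i \<in> carrier_mat n m \<and> C i \<in> carrier_mat m m"
  shows "star_Sylvester_solvable star l m n A B C \<longleftrightarrow>
    simultaneously_star_congruent star l (m + n)
      (\<lambda>i. four_block_mat (C i) (- A i) (B i) (0\<^sub>m n n))
      (\<lambda>i. four_block_mat (0\<^sub>m m m) (- A i) (B i) (0\<^sub>m n n))"
proof
  assume "star_Sylvester_solvable star l m n A B C"
  then obtain X where X: "X \<in> carrier_mat n m" "\<And>i. i \<in> {1..l} \<Longrightarrow> A i * X - star X * B i = C i"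
    by (auto simp: star_Sylvester_solvable_def)
  let ?S = "four_block_mat (1\<^sub>m m) (star X) (0\<^sub>m n m) (1\<^sub>m n)"
  have "?S \<in> carrier_mat (m + n) (m + n)" "invertible_mat ?S"
    using X(1) by (auto intro: invertible_unitriangular)
  then show "simultaneously_star_congruent star l (m + n)
      (\<lambda>i. four_block_mat (C i) (- A i) (B i) (0\<^sub>m n n))
      (\<lambda>i. four_block_mat (0\<^sub>m m m) (- A i) (B i) (0\<^sub>m n n))"
    unfolding simultaneously_star_congruent_def
  proof (intro bexI[of _ ?S] conjI ballI)
    fix i assume i: "i \<in> {1..l}"
    then show "?S * four_block_mat (C i) (- A i) (B i) (0\<^sub>m n n) * star ?S
        = four_block_mat (0\<^sub>m m m) (- A i) (B i) (0\<^sub>m n n)"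
      using carr X by (intro congruent_if_star_Sylvester) auto
  qed
next
  assume "simultaneously_star_congruent star l (m + n)
      (\<lambda>i. four_block_mat (C i) (- A i) (B i) (0\<^sub>m n n))
      (\<lambda>i. four_block_mat (0\<^sub>m m m) (- A i) (B i) (0\<^sub>m n n))"
  then obtain S where S: "S \<in> carrier_mat (m + n) (m + n)" "invertible_mat S"
    "\<And>i. i \<in> {1..l} \<Longrightarrow> S * four_block_mat (C i) (- A i) (B i) (0\<^sub>m n n) * star S
        = four_block_mat (0\<^sub>m m m) (- A i) (B i) (0\<^sub>m n n)"
    unfolding simultaneously_star_congruent_def by blast
  have c: "A i \<in> carrier_mat m n" "B i \<in> carrier_mat n m" "C i \<in> carrier_mat m m"
    if "i \<in> {1..l}" for i
    using carr that by blast+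
  show "star_Sylvester_solvable star l m n A B C"
    unfolding star_Sylvester_solvable_def
    by (rule star_Sylvester_if_star_congruent[where S = S]) (fact assms(1) c S)+
qed

end

lemma two_neq_zero_of_CHAR:
  assumes "CHAR('a::field) \<noteq> 2"
  shows "(2 :: 'a) \<noteq> 0"
proof
  assume "(2 :: 'a) = 0"
  then have "CHAR('a) dvd 2"
    using of_nat_eq_0_iff_char_dvd[of 2, where 'a = 'a] by simp
  moreover have "CHAR('a) \<noteq> 1"
    by simp
  ultimately show False
    using assms two_is_prime_nat prime_nat_iff by blast
qed

theorem theorem1:
  fixes l m n :: nat
  assumes "l \<ge> 1" and "m \<ge> 1" and "n \<ge> 1"
  shows
    "(CHAR('a::field) \<noteq> 2 \<longrightarrow>
       (\<forall>A B C :: nat \<Rightarrow> 'a mat.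
          (\<forall>i\<in>{1..l}. A i \<in> carrier_mat m n \<and> B i \<in> carrier_mat n m \<and> C i \<in> carrier_mat m m) \<longrightarrow>
          (star_Sylvester_solvable transpose_mat l m n A B C \<longleftrightarrow>
           simultaneously_star_congruent transpose_mat l (m + n)
             (\<lambda>i. four_block_mat (C i) (- A i) (B i) (0\<^sub>m n n))
             (\<lambda>i. four_block_mat (0\<^sub>m m m) (- A i) (B i) (0\<^sub>m n n)))))
     \<and>
     (\<forall>A B C :: nat \<Rightarrow> complex mat.
        (\<forall>i\<in>{1..l}. A i \<in> carrier_mat m n \<and> B i \<in> carrier_mat n m \<and> C i \<in> carrier_mat m m) \<longrightarrow>
        (star_Sylvester_solvable mat_adjoint l m n A B C \<longleftrightarrow>
         simultaneously_star_congruent mat_adjoint l (m + n)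
           (\<lambda>i. four_block_mat (C i) (- A i) (B i) (0\<^sub>m n n))
           (\<lambda>i. four_block_mat (0\<^sub>m m m) (- A i) (B i) (0\<^sub>m n n))))"
proof -
  interpret id: field_involution "\<lambda>x::'a. x"
    by unfold_locales auto
  interpret cnj: field_involution cnj
    by unfold_locales auto
  have "id.star = transpose_mat"
    by (rule ext, rule eq_matI) (auto simp: id.star_def)
  moreover have "cnj.star = mat_adjoint"
    by (rule ext) (simp add: cnj.star_def mat_adjoint_complex)
  ultimately show ?thesis
    using id.star_Sylvester_solvable_iff_star_congruent[OF two_neq_zero_of_CHAR]
      cnj.star_Sylvester_solvable_iff_star_congruent[OF two_neq_zero_of_CHAR] by simp
qed

end
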